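(* Let $D$ be a finite corpus of documents with words $w_{d,i}$ ($d\in D$, $1\le i\le |d|$), let $\phi_1,\dots,\phi_k$ be fixed topics, and let all Dirichlet parameters be equal, $\alpha_1=\dots=\alpha_k=\alpha>0$. Let $\log P(Z\mid D)$ denote the LDA log posterior (which depends on $\alpha$) of a topic-word assignment $Z=(z_{d,i})$, $z_{d,i}\in\{1,\dots,k\}$, as given in the context. Then $$\lim_{\alpha\to\infty}\Big(\operatorname*{argmax}_{Z}\ \log P(Z\mid D)\Big)\;=\;\operatorname*{argmax}_{Z}\ \sum_{d\in D}\sum_{i=1}^{|d|}\log Cat\big(w_{d,i}\mid z_{d,i},\phi_{z_{d,i}}\big).$$
   Context: A vocabulary $V$ is a finite set of words. A corpus $D$ is a finite set of documents; each document $d$ is a finite multiset (list) of words $d=[w_{d,1},\dots,w_{d,|d|}]$, $w_{d,i}\in V$. A topic $\phi_\tau$ is a probability distribution over $V$, and $\phi_\tau[v]$ is the probability of $v\in V$. $Cat(w_{d,i}\mid z_{d,i},\phi_{z_{d,i}})=\phi_{z_{d,i}}[w_{d,i}]$ is the probability that the topic assigned to word position $i$ of document $d$ draws the word $w_{d,i}$. The argmax is over all assignments $Z=(z_{d,i})$ of a topic to every word position of every document. In the Latent Dirichlet Allocation (LDA) model with fixed topics, each document $d$ draws a topic mixture $\theta_d\sim\mathrm{Dirichlet}(\alpha_1,\dots,\alpha_k)$, then for each word position $i$ draws a topic $z_{d,i}\sim\mathrm{Categorical}(\theta_d)$ and a word $w_{d,i}\sim\mathrm{Categorical}(\phi_{z_{d,i}})$.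 After integrating out the $\theta_d$, the log posterior of $Z$ is, up to an additive constant not depending on $Z$, $$\log P(Z\mid D)=\sum_{d\in D}\Big(\sum_{i=1}^{|d|}\log Cat(w_{d,i}\mid z_{d,i},\phi_{z_{d,i}})+\sum_{\tau=1}^k\log\Gamma(n_{d,\tau}+\alpha_\tau)+\log\Gamma\big(\textstyle\sum_{\tau=1}^k\alpha_\tau\big)-\log\Gamma\big(\textstyle\sum_{\tau=1}^k\alpha_\tau+|d|\big)-\sum_{\tau=1}^k\log\Gamma(\alpha_\tau)\Big),$$ where $n_{d,\tau}=|\{i: z_{d,i}=\tau\}|$ is the number of words of $d$ assigned to topic $\tau$, and $\Gamma$ is the Gamma function.
   Formalization: With ties the equality of argmax sets can fail (two equal topics, one document with one word twice); proved instead: the limit of the argmax sets exists, is non-empty, lies in the right-hand argmax, and equals it when the right-hand maximiser is unique. *)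

theory Defs
  imports "HOL-Probability.Probability"
begin

(* A corpus is a finite set D of document names together with w :: 'd => 'v list, so that two
   documents may consist of the same words. Word positions of d are 0, ..., length (w d) - 1,
   topics are 1, ..., k. *)

definition assignments :: "'d set \<Rightarrow> ('d \<Rightarrow> 'v list) \<Rightarrow> nat \<Rightarrow> ('d \<Rightarrow> nat \<Rightarrow> nat) set" where
  "assignments D w k = (\<Pi>\<^sub>E d\<in>D. \<Pi>\<^sub>E i\<in>{..<length (w d)}. {1..k})"

definition topic_count :: "('d \<Rightarrow> 'v list) \<Rightarrow> ('d \<Rightarrow> nat \<Rightarrow> nat) \<Rightarrow> 'd \<Rightarrow> nat \<Rightarrow> nat" where
  "topic_count w Z d \<tau> = card {i. i < length (w d) \<and> Z d i = \<tau>}"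

(* A word may have probability 0 under a topic, while ln 0 = 0 in the library; hence the
   logarithm with log 0 = -\<infinity>. *)
definition log_prob :: "real \<Rightarrow> ereal" where
  "log_prob p = (if p = 0 then - \<infinity> else ereal (ln p))"

definition Cat :: "'v \<Rightarrow> nat \<Rightarrow> (nat \<Rightarrow> 'v pmf) \<Rightarrow> real" where
  "Cat v \<tau> \<phi> = pmf (\<phi> \<tau>) v"

definition log_likelihood ::
  "'d set \<Rightarrow> ('d \<Rightarrow> 'v list) \<Rightarrow> (nat \<Rightarrow> 'v pmf) \<Rightarrow> ('d \<Rightarrow> nat \<Rightarrow> nat) \<Rightarrow> ereal" where
  "log_likelihood D w \<phi> Z = (\<Sum>d\<in>D. \<Sum>i<length (w d). log_prob (Cat (w d ! i) (Z d i) \<phi>))"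

definition log_posterior ::
  "'d set \<Rightarrow> ('d \<Rightarrow> 'v list) \<Rightarrow> nat \<Rightarrow> (nat \<Rightarrow> 'v pmf) \<Rightarrow> (nat \<Rightarrow> real) \<Rightarrow>
     ('d \<Rightarrow> nat \<Rightarrow> nat) \<Rightarrow> ereal" where
  "log_posterior D w k \<phi> \<alpha> Z =
     (\<Sum>d\<in>D. (\<Sum>i<length (w d). log_prob (Cat (w d ! i) (Z d i) \<phi>))
        + ereal ((\<Sum>\<tau>=1..k. ln (Gamma (real (topic_count w Z d \<tau>) + \<alpha> \<tau>)))
                 + ln (Gamma (\<Sum>\<tau>=1..k. \<alpha> \<tau>))
                 - ln (Gamma ((\<Sum>\<tau>=1..k. \<alpha> \<tau>) + real (length (w d))))
                 - (\<Sum>\<tau>=1..k. ln (Gamma (\<alpha> \<tau>)))))"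

(* The set of all maximisers of f over A. *)
definition argmax_on :: "'a set \<Rightarrow> ('a \<Rightarrow> 'b::ord) \<Rightarrow> 'a set" where
  "argmax_on A f = {x. is_arg_max f (\<lambda>x. x \<in> A) x}"

end

theory Submission
  imports Defs
begin

text \<open>For \<open>\<alpha> > 0\<close> the recurrence of \<open>\<Gamma>\<close> turns \<open>exp (log P(Z | D))\<close> into a positive factor independent of \<open>Z\<close>
  times a polynomial in \<open>\<alpha>\<close>: the likelihood of \<open>Z\<close> times a monic polynomial whose degree is the
  total number of words. Finitely many real polynomials are eventually ordered as in the ordered
  ring of polynomials, so the argmax is eventually constant, and as all degrees agree that order
  refines the order of the leading coefficients, that is, of the likelihoods.\<close>

text \<open>Being a maximiser depends only on strict comparisons of values, so \<open>f\<close> and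
  \<open>g\<close> may have different codomains. This lets extended real posteriors be exchanged for
  polynomials.\<close>

lemma argmax_on_cong_less:
  assumes "\<And>x y. x \<in> A \<Longrightarrow> y \<in> A \<Longrightarrow> f x < f y \<longleftrightarrow> g x < g y"
  shows "argmax_on A f = argmax_on A g"
  using assms by (auto simp: argmax_on_def is_arg_max_def)

lemma argmax_on_nonempty:
  fixes f :: "'a \<Rightarrow> 'b::linorder"
  assumes "finite A" "A \<noteq> {}"
  shows "argmax_on A f \<noteq> {}"
proof -
  have "Max (f ` A) \<in> f ` A"
    using assms by (intro Max_in) auto
  then obtain x where "x \<in> A" "f x = Max (f ` A)"
    by auto
  then have "x \<in> argmax_on A f"
    using assms(1) by (auto simp: argmax_on_def is_arg_max_def not_less)
  then show ?thesis
    by blast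
qed

lemma less_poly_iff_lead_coeff: "p < q \<longleftrightarrow> 0 < lead_coeff (q - p)"
  for p q :: "'a::linordered_idom poly"
  by (simp add: less_poly_def pos_poly_def)

text \<open>The difference has positive leading coefficient, and such a polynomial eventually stays
  above that coefficient.\<close>

lemma eventually_poly_less:
  fixes p q :: "real poly"
  assumes "p < q"
  shows "eventually (\<lambda>x. poly p x < poly q x) at_top"
proof -
  have lc: "0 < lead_coeff (q - p)"
    using assms by (simp add: less_poly_iff_lead_coeff)
  obtain n where "\<forall>x\<ge>n. lead_coeff (q - p) \<le> poly (q - p) x"
    using poly_pinfty_gt_lc[OF lc] by blast
  with lc have "\<forall>x\<ge>n. poly p x < poly q x"
    by force
  then show ?thesis
    by (auto simp: eventually_at_top_linorder)
qed

lemma eventually_poly_less_iff: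
  fixes p q :: "real poly"
  shows "eventually (\<lambda>x. poly p x < poly q x \<longleftrightarrow> p < q) at_top"
proof (cases p q rule: linorder_cases)
  case less
  from eventually_poly_less[OF this] show ?thesis
    by (rule eventually_mono) (simp add: less)
next
  case greater
  from eventually_poly_less[OF this] show ?thesis
    by (rule eventually_mono) (use greater in auto)
qed auto

text \<open>In the common degree the difference has coefficient \<open>b - a\<close>, which is
  nonzero and hence leading; its sign decides.\<close>

lemma smult_less_smult_if_monic:
  fixes p q :: "real poly"
  assumes "a < b" "lead_coeff p = 1" "lead_coeff q = 1" "degree p = degree q"
  shows "smult a p < smult b q"
proof -
  let ?r = "smult b q - smult a p"
  have c: "coeff ?r (degree q) = b - a"
    using assms by simp
  have "degree ?r \<le> degree q"
    using assms(4) by (intro degree_diff_le) auto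
  moreover have "degree q \<le> degree ?r"
    using c assms(1) by (intro le_degree) simp
  ultimately have "degree ?r = degree q"
    by simp
  with c assms(1) show ?thesis
    by (simp add: less_poly_iff_lead_coeff)
qed

lemma poly_pochhammer_X: "poly (pochhammer [:0, 1:] n) x = pochhammer x n"
  for x :: "'a::comm_ring_1"
  by (induction n) (simp_all add: pochhammer_Suc of_nat_poly algebra_simps)

text \<open>The polynomial is X (X + 1) ... (X + n - 1), a product of \<open>n\<close> monic linear
  factors.\<close>

lemma
  shows degree_pochhammer_X: "degree (pochhammer [:0, 1:] n :: 'a::idom poly) = n"
    and lead_coeff_pochhammer_X: "lead_coeff (pochhammer [:0, 1:] n :: 'a poly) = 1"
proof (induction n)
  case (Suc n)
  have X: "[:0, 1:] + of_nat n = [:of_nat n, 1 :: 'a:]"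
    by (simp add: of_nat_poly)
  have nz: "(pochhammer [:0, 1:] n :: 'a poly) \<noteq> 0"
    using Suc(2) by auto
  show "degree (pochhammer [:0, 1:] (Suc n) :: 'a poly) = Suc n"
    unfolding pochhammer_Suc X using nz Suc(1) by (subst degree_mult_eq) auto
  show "lead_coeff (pochhammer [:0, 1:] (Suc n) :: 'a poly) = 1"
    unfolding pochhammer_Suc X lead_coeff_mult Suc(2) by simp
qed auto

text \<open>The product rule survives vanishing factors, since \<open>log_prob\<close> never takes
  the value \<infinity> and so -\<infinity> absorbs the other summand.\<close>

lemma log_prob_mult:
  assumes "0 \<le> a" "0 \<le> b"
  shows "log_prob (a * b) = log_prob a + log_prob b"
  using assms by (auto simp: log_prob_def ln_mult)

lemma log_prob_prod:
  assumes "\<And>i. i \<in> A \<Longrightarrow> 0 \<le> f i"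
  shows "log_prob (\<Prod>i\<in>A. f i) = (\<Sum>i\<in>A. log_prob (f i))"
  using assms
proof (induction A rule: infinite_finite_induct)
  case (insert x A)
  then show ?case
    by (simp add: log_prob_mult prod_nonneg)
qed (auto simp: log_prob_def)

lemma log_prob_less_iff:
  assumes "0 \<le> a" "0 \<le> b"
  shows "log_prob a < log_prob b \<longleftrightarrow> a < b"
  using assms by (auto simp: log_prob_def)

lemma add_ereal_less_iff: "a + ereal r < b + ereal r \<longleftrightarrow> a < b"
  by (cases a; cases b) auto

text \<open>Kept real-valued so that it can serve as a coefficient; impossible assignments get the
  zero polynomial.\<close>

definition likelihood :: "'d set \<Rightarrow> ('d \<Rightarrow> 'v list) \<Rightarrow> (nat \<Rightarrow> 'v pmf) \<Rightarrow> ('d \<Rightarrow> nat \<Rightarrow> nat) \<Rightarrow> real" where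
  "likelihood D w \<phi> Z = (\<Prod>d\<in>D. \<Prod>i<length (w d). Cat (w d ! i) (Z d i) \<phi>)"

text \<open>The product of all quotients \<Gamma>(n + \<alpha>) / \<Gamma>(\<alpha>), n a topic
  count, as a polynomial in \<alpha>.\<close>

definition count_poly :: "'d set \<Rightarrow> ('d \<Rightarrow> 'v list) \<Rightarrow> nat \<Rightarrow> ('d \<Rightarrow> nat \<Rightarrow> nat) \<Rightarrow> real poly" where
  "count_poly D w k Z = (\<Prod>d\<in>D. \<Prod>\<tau>=1..k. pochhammer [:0, 1:] (topic_count w Z d \<tau>))"

lemma likelihood_nonneg: "0 \<le> likelihood D w \<phi> Z"
  by (auto simp: likelihood_def Cat_def intro!: prod_nonneg)

lemma log_likelihood_eq: "log_likelihood D w \<phi> Z = log_prob (likelihood D w \<phi> Z)"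
  by (simp add: log_likelihood_def likelihood_def log_prob_prod prod_nonneg Cat_def)

text \<open>The positions of \<open>d\<close> are partitioned by their topics, all of which lie in
  \<open>{1..k}\<close>.\<close>

lemma sum_topic_count:
  assumes "Z \<in> assignments D w k" "d \<in> D"
  shows "(\<Sum>\<tau>=1..k. topic_count w Z d \<tau>) = length (w d)"
proof -
  have "(\<lambda>i. Z d i) ` {..<length (w d)} \<subseteq> {1..k}"
    using assms by (auto simp: assignments_def PiE_iff)
  then have "(\<Sum>\<tau>=1..k. \<Sum>i\<in>{i \<in> {..<length (w d)}. Z d i = \<tau>}. 1) = (\<Sum>i<length (w d). 1::nat)"
    by (intro sum.group) auto
  then show ?thesis
    by (simp add: topic_count_def)
qed

lemma lead_coeff_count_poly: "lead_coeff (count_poly D w k Z) = 1"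
  unfolding count_poly_def lead_coeff_prod lead_coeff_pochhammer_X by simp

lemma degree_count_poly:
  assumes "Z \<in> assignments D w k"
  shows "degree (count_poly D w k Z) = (\<Sum>d\<in>D. length (w d))"
proof -
  have nz: "(pochhammer [:0, 1:] n :: real poly) \<noteq> 0" for n
    using lead_coeff_pochhammer_X[of n, where 'a = real] by auto
  have "degree (count_poly D w k Z) = (\<Sum>d\<in>D. \<Sum>\<tau>=1..k. topic_count w Z d \<tau>)"
  \<comment> \<open>For infinite \<open>D\<close> the product defaults to 1 and the sum to 0, so
    both sides are 0.\<close>
  proof (cases "finite D")
    case True
    then show ?thesis
      by (simp add: count_poly_def degree_prod_eq_sum_degree nz degree_pochhammer_X)
  qed (simp add: count_poly_def)
  then show ?thesis
    by (simp only: sum_topic_count[OF assms] cong: sum.cong)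
qed

lemma poly_count_poly:
  "poly (count_poly D w k Z) x = (\<Prod>d\<in>D. \<Prod>\<tau>=1..k. pochhammer x (topic_count w Z d \<tau>))"
  by (simp add: count_poly_def poly_prod poly_pochhammer_X)

lemma poly_count_poly_pos: "x > 0 \<Longrightarrow> poly (count_poly D w k Z) x > 0"
  by (auto simp: poly_count_poly intro!: prod_pos pochhammer_pos)

text \<open>This is \<Gamma>(x + 1) = x \<Gamma>(x) applied \<open>n\<close> times; both factors are
  positive, so the logarithm splits.\<close>

lemma ln_Gamma_add_of_nat:
  fixes x :: real
  assumes "x > 0"
  shows "ln (Gamma (real n + x)) = ln (pochhammer x n) + ln (Gamma x)"
proof -
  have "x \<notin> \<int>\<^sub>\<le>\<^sub>0"
    using assms by (auto elim!: nonpos_Ints_cases)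
  then have "Gamma (real n + x) = pochhammer x n * Gamma x"
    using Gamma_real_pos[OF assms] by (simp add: pochhammer_Gamma add.commute)
  then show ?thesis
    using Gamma_real_pos[OF assms] pochhammer_pos[OF assms, of n] by (simp add: ln_mult_pos)
qed

text \<open>Isolates the dependence on \<open>Z\<close> in one polynomial value; the remaining
  summand is finite and thus cancels in comparisons.\<close>

lemma log_posterior_eq:
  fixes \<alpha> :: real
  assumes "\<alpha> > 0"
  shows "log_posterior D w k \<phi> (\<lambda>_. \<alpha>) Z =
    log_prob (poly (smult (likelihood D w \<phi> Z) (count_poly D w k Z)) \<alpha>)
    + ereal (\<Sum>d\<in>D. ln (Gamma (k * \<alpha>)) - ln (Gamma (k * \<alpha> + length (w d))))"
proof -
  have r: "(\<Sum>\<tau>=1..k. ln (Gamma (real (topic_count w Z d \<tau>) + \<alpha>))) - (\<Sum>\<tau>=1..k. ln (Gamma \<alpha>))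
      = ln (\<Prod>\<tau>=1..k. pochhammer \<alpha> (topic_count w Z d \<tau>))" for d
    using pochhammer_pos[OF assms]
    by (subst ln_prod) (auto simp: ln_Gamma_add_of_nat[OF assms] sum.distrib less_imp_neq[symmetric])
  have pos: "(\<Prod>\<tau>=1..k. pochhammer \<alpha> (topic_count w Z d \<tau>)) > 0" for d
    using pochhammer_pos[OF assms] by (intro prod_pos) auto
  have "(\<Sum>d\<in>D. ln (\<Prod>\<tau>=1..k. pochhammer \<alpha> (topic_count w Z d \<tau>)))
      = ln (poly (count_poly D w k Z) \<alpha>)"
    unfolding poly_count_poly
    by (cases "finite D") (use pos in \<open>auto simp: ln_prod less_imp_neq[symmetric]\<close>)
  moreover have "log_posterior D w k \<phi> (\<lambda>_. \<alpha>) Z = log_likelihood D w \<phi> Z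
      + (\<Sum>d\<in>D. ereal (ln (\<Prod>\<tau>=1..k. pochhammer \<alpha> (topic_count w Z d \<tau>))
          + (ln (Gamma (k * \<alpha>)) - ln (Gamma (k * \<alpha> + length (w d))))))"
    unfolding log_posterior_def log_likelihood_def r[symmetric] sum.distrib[symmetric]
    by (intro sum.cong refl arg_cong2[where f = "(+)"]) (simp add: algebra_simps)
  ultimately have "log_posterior D w k \<phi> (\<lambda>_. \<alpha>) Z = log_likelihood D w \<phi> Z
      + (ereal (ln (poly (count_poly D w k Z) \<alpha>))
      + ereal (\<Sum>d\<in>D. ln (Gamma (k * \<alpha>)) - ln (Gamma (k * \<alpha> + length (w d)))))"
    by (simp add: sum.distrib)
  moreover have "log_prob (poly (smult (likelihood D w \<phi> Z) (count_poly D w k Z)) \<alpha>)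
      = log_likelihood D w \<phi> Z + ereal (ln (poly (count_poly D w k Z) \<alpha>))"
    using poly_count_poly_pos[OF assms, of D w k Z] likelihood_nonneg[of D w \<phi> Z]
    by (simp add: log_prob_mult log_likelihood_eq) (simp add: log_prob_def)
  ultimately show ?thesis
    by (simp only: add.assoc)
qed

theorem theorem1:
  fixes V :: "'v set" and D :: "'d set" and w :: "'d \<Rightarrow> 'v list"
    and k :: nat and \<phi> :: "nat \<Rightarrow> 'v pmf"
  assumes "finite V"
    and "finite D"
    and "\<And>d. d \<in> D \<Longrightarrow> set (w d) \<subseteq> V"
    and "k \<ge> 1"
    and "\<And>\<tau>. \<tau> \<in> {1..k} \<Longrightarrow> set_pmf (\<phi> \<tau>) \<subseteq> V"
  shows "\<exists>L. limitin (discrete_topology (Pow (assignments D w k)))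
               (\<lambda>\<alpha>::real. argmax_on (assignments D w k) (log_posterior D w k \<phi> (\<lambda>_. \<alpha>))) L at_top
           \<and> L \<noteq> {}
           \<and> L \<subseteq> argmax_on (assignments D w k) (log_likelihood D w \<phi>)
           \<and> ((\<exists>!Z. Z \<in> argmax_on (assignments D w k) (log_likelihood D w \<phi>))
                \<longrightarrow> L = argmax_on (assignments D w k) (log_likelihood D w \<phi>))"
proof -
  let ?A = "assignments D w k" and ?P = "\<lambda>Z. smult (likelihood D w \<phi> Z) (count_poly D w k Z)"
  let ?post = "\<lambda>\<alpha>::real. log_posterior D w k \<phi> (\<lambda>_. \<alpha>)"
  have fin: "finite ?A"
    unfolding assignments_def using assms(2) by (intro finite_PiE) auto
  have ne: "?A \<noteq> {}"
    unfolding assignments_def using assms(4) by (auto simp: PiE_eq_empty_iff)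
  \<comment> \<open>The order of polynomials does not involve \<alpha>, so its maximisers are the
    candidate for the limit.\<close>
  define L where "L = argmax_on ?A ?P"
  \<comment> \<open>There are finitely many pairs of assignments, so one threshold for \<alpha>
    serves them all.\<close>
  have "eventually (\<lambda>\<alpha>. \<forall>Z\<in>?A. \<forall>Z'\<in>?A. poly (?P Z) \<alpha> < poly (?P Z') \<alpha> \<longleftrightarrow> ?P Z < ?P Z') at_top"
    by (intro eventually_ball_finite ballI fin eventually_poly_less_iff)
  with eventually_gt_at_top[of 0] have "eventually (\<lambda>\<alpha>. argmax_on ?A (?post \<alpha>) = L) at_top"
  proof eventually_elim
    case (elim \<alpha>)
    have "0 \<le> poly (?P Z) \<alpha>" for Z
      using poly_count_poly_pos[OF elim(1), of D w k Z] likelihood_nonneg[of D w \<phi> Z] by simp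
    then have "?post \<alpha> Z < ?post \<alpha> Z' \<longleftrightarrow> poly (?P Z) \<alpha> < poly (?P Z') \<alpha>" for Z Z'
      by (simp only: log_posterior_eq[OF elim(1)] add_ereal_less_iff log_prob_less_iff)
    with elim(2) show ?case
      unfolding L_def by (intro argmax_on_cong_less) blast
  qed
  moreover have "L \<in> Pow ?A"
    by (auto simp: L_def argmax_on_def is_arg_max_def)
  \<comment> \<open>Eventual equality with \<open>L\<close> gives convergence in any topology whose
    space contains \<open>L\<close>.\<close>
  ultimately have lim: "limitin (discrete_topology (Pow ?A)) (\<lambda>\<alpha>. argmax_on ?A (?post \<alpha>)) L at_top"
    by (intro limitin_eventually) auto
  have Lne: "L \<noteq> {}"
    unfolding L_def by (rule argmax_on_nonempty[OF fin ne])
  \<comment> \<open>An assignment beaten in likelihood is also beaten as a polynomial, so it cannot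
    lie in \<open>L\<close>.\<close>
  have "?P Z < ?P Z'" if "Z \<in> ?A" "Z' \<in> ?A" "log_likelihood D w \<phi> Z < log_likelihood D w \<phi> Z'" for Z Z'
    using that
    by (intro smult_less_smult_if_monic lead_coeff_count_poly)
      (simp_all add: log_likelihood_eq log_prob_less_iff likelihood_nonneg degree_count_poly)
  then have sub: "L \<subseteq> argmax_on ?A (log_likelihood D w \<phi>)"
    by (fastforce simp: L_def argmax_on_def is_arg_max_def)
  \<comment> \<open>If the likelihood has a unique maximiser, the nonempty subset \<open>L\<close>
    of that singleton is all of it.\<close>
  show ?thesis
    using lim Lne sub by (intro exI[of _ L]) blast
qed

end
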